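(* For each integer $k\ge 3$, let $\lambda_k$ denote the unique positive real root of the polynomial $X^{k}-\sum_{j=0}^{k-2}X^{j}$, and let $F_n$ denote the $n$-th Fibonacci number. Then for every integer $k\ge 3$, $$\frac{F_{k+1}}{F_k+1}<\lambda_k<\frac{F_{k+1}}{F_k}.$$
   Context: The Fibonacci numbers are defined by $F_0=0$, $F_1=1$ and $F_n=F_{n-1}+F_{n-2}$ for $n\ge 2$. For every integer $k\ge 3$ the polynomial $X^{k}-\sum_{j=0}^{k-2}X^{j}=X^k-X^{k-2}-\cdots-X-1$ has exactly one positive real root, denoted $\lambda_k$. *)

theory Defs
  imports
    "HOL-Analysis.Analysis"
    "HOL-Computational_Algebra.Polynomial"
    "HOL-Number_Theory.Fib"
begin

definition lambda_poly :: "nat \<Rightarrow> real poly" where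
  "lambda_poly k = monom 1 k - (\<Sum>j = 0..k - 2. monom 1 j)"

(* Meaningful for k >= 3 only; ex1_positive_root below shows that the description is proper. *)
definition lambda :: "nat \<Rightarrow> real" where
  "lambda k = (THE x. 0 < x \<and> poly (lambda_poly k) x = 0)"

lemma poly_lambda_poly: "poly (lambda_poly k) x = x ^ k - (\<Sum>j = 0..k - 2. x ^ j)"
  by (simp add: lambda_poly_def poly_monom poly_sum)

lemma positive_root_not_less:
  fixes x y :: real
  assumes k: "k \<ge> 3" and x: "0 < x" "poly (lambda_poly k) x = 0"
    and y: "poly (lambda_poly k) y = 0"
  shows "\<not> x < y"
proof
  assume less: "x < y"
  have "(\<Sum>j = 0..k - 2. y ^ j * x ^ k) < (\<Sum>j = 0..k - 2. x ^ j * y ^ k)"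
  proof (rule sum_strict_mono)
    fix j assume "j \<in> {0..k - 2}"
    then have j: "k = j + (k - j)" "0 < k - j" using k by auto
    have "x ^ (k - j) < y ^ (k - j)"
      using less x j by (intro power_strict_mono) auto
    then have "(x ^ j * y ^ j) * x ^ (k - j) < (x ^ j * y ^ j) * y ^ (k - j)"
      using less x by (intro mult_strict_left_mono) auto
    moreover have "x ^ k = x ^ j * x ^ (k - j)" "y ^ k = y ^ j * y ^ (k - j)"
      using j(1) by (metis power_add)+
    ultimately show "y ^ j * x ^ k < x ^ j * y ^ k"
      by (simp add: mult_ac)
  qed auto
  then have "(\<Sum>j = 0..k - 2. y ^ j) * x ^ k < (\<Sum>j = 0..k - 2. x ^ j) * y ^ k"
    by (simp add: sum_distrib_right)
  then show False
    using x(2) y by (simp add: poly_lambda_poly)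
qed

lemma ex1_positive_root:
  assumes k: "k \<ge> 3"
  shows "\<exists>!x. 0 < x \<and> poly (lambda_poly k) x = 0"
proof -
  have "poly (lambda_poly k) 1 < 0"
    using k by (simp add: poly_lambda_poly of_nat_diff)
  moreover have "poly (lambda_poly k) 2 > 0"
  proof -
    have "(\<Sum>j = 0..n. (2::real) ^ j) < 2 ^ Suc n" for n
      by (induction n) auto
    from this[of "k - 2"] have "(\<Sum>j = 0..k - 2. (2::real) ^ j) < 2 ^ Suc (k - 2)" .
    also have "\<dots> \<le> 2 ^ k"
      using k by (intro power_increasing) auto
    finally show ?thesis by (simp add: poly_lambda_poly)
  qed
  ultimately obtain x where "1 < x" "poly (lambda_poly k) x = 0"
    using poly_IVT_pos[of 1 2 "lambda_poly k"] by auto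
  then show ?thesis
    using positive_root_not_less[OF k] by (intro ex1I[of _ x]) (auto, meson linorder_neqE not_less_iff_gr_or_eq order.strict_trans zero_less_one)
qed

end

theory Submission
  imports Defs
begin

text \<open>
  Write \<open>P\<close> for the polynomial, \<open>a\<close> for \<open>F(k+1)\<close> and \<open>b\<close> for \<open>F(k)\<close>. Since \<open>P(x) / x^k\<close> is strictly
  increasing on the positive reals, a positive \<open>x\<close> lies below or above the root according to the
  sign of \<open>P(x)\<close>. Summing the geometric series gives
  \<open>(x - 1) P(x) = x^(k-1) (x^2 - x - 1) + 1\<close>, so for \<open>x > 1\<close> the sign is that of the right-hand
  side, which is accessible at both bounds because \<open>a^2 - a b - b^2 = (-1)^k\<close>.

  At \<open>x = a/b\<close> the right-hand side is \<open>1 + (-1)^k x^(k-1) / b^2\<close>. It is positive because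
  \<open>x \<le> 5/3\<close>, while \<open>b^2\<close> grows faster than \<open>(5/3)^(k-1)\<close>.

  At \<open>x = a/(b+1)\<close> it is \<open>1 - x^(k-1) (a + 2 b + 1 - (-1)^k) / (b+1)^2\<close>, so what is needed is that
  \<open>x^(k-1) (a + 2 b)\<close> exceeds \<open>(b+1)^2\<close>. With the golden ratio \<open>p\<close>, the identity
  \<open>a = p b + (1 - p)^k\<close> shows that \<open>x\<close> equals \<open>p\<close> up to a relative error of order \<open>1/(b+1)\<close>; by
  Bernoulli's inequality \<open>x^(k-1)\<close> is then a constant fraction of \<open>p^(k-1)\<close>, which is at least \<open>b\<close>.
  These estimates suffice from \<open>k = 7\<close> on; the values \<open>k = 4, 5, 6\<close> are computed, and for \<open>k = 3\<close>
  the bound is \<open>1\<close>, where \<open>P\<close> is visibly negative.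
\<close>

section \<open>Locating the root by the sign of the polynomial\<close>

text \<open>This is the monotonicity of \<open>P(x) / x^k = 1 - (\<Sum>j\<le>k-2. x^(j-k))\<close>, cleared of denominators.\<close>

lemma lambda_poly_cross_less:
  fixes x y :: real
  assumes k: "k \<ge> 2" and x: "0 < x" and less: "x < y"
  shows "poly (lambda_poly k) x * y ^ k < poly (lambda_poly k) y * x ^ k"
proof -
  have "(\<Sum>j = 0..k - 2. y ^ j * x ^ k) < (\<Sum>j = 0..k - 2. x ^ j * y ^ k)"
  proof (rule sum_strict_mono)
    fix j assume "j \<in> {0..k - 2}"
    then have j: "k = j + (k - j)" "0 < k - j" using k by auto
    have "x ^ (k - j) < y ^ (k - j)"
      using less x j by (intro power_strict_mono) auto
    then have "(x ^ j * y ^ j) * x ^ (k - j) < (x ^ j * y ^ j) * y ^ (k - j)"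
      using less x by (intro mult_strict_left_mono) auto
    moreover have "x ^ k = x ^ j * x ^ (k - j)" "y ^ k = y ^ j * y ^ (k - j)"
      using j(1) by (metis power_add)+
    ultimately show "y ^ j * x ^ k < x ^ j * y ^ k"
      by (simp add: mult_ac)
  qed auto
  then have "(\<Sum>j = 0..k - 2. y ^ j) * x ^ k < (\<Sum>j = 0..k - 2. x ^ j) * y ^ k"
    by (simp add: sum_distrib_right)
  then show ?thesis
    by (simp add: poly_lambda_poly algebra_simps)
qed

lemma lambda_root:
  assumes "k \<ge> 3"
  shows "0 < lambda k" "poly (lambda_poly k) (lambda k) = 0"
  using theI'[OF ex1_positive_root[OF assms]] by (auto simp: lambda_def)

lemma less_lambda:
  assumes k: "k \<ge> 3" and neg: "poly (lambda_poly k) x < 0"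
  shows "x < lambda k"
proof (rule ccontr)
  assume "\<not> x < lambda k"
  then have "lambda k < x"
    using neg lambda_root[OF k] by (cases "x = lambda k") auto
  then have "0 < poly (lambda_poly k) x * lambda k ^ k"
    using lambda_poly_cross_less[of k "lambda k" x] lambda_root[OF k] k by simp
  then show False
    using neg lambda_root(1)[OF k] by (simp add: zero_less_mult_iff)
qed

lemma lambda_less:
  assumes k: "k \<ge> 3" and "0 < x" and pos: "0 < poly (lambda_poly k) x"
  shows "lambda k < x"
proof (rule ccontr)
  assume "\<not> lambda k < x"
  then have "x < lambda k"
    using pos lambda_root[OF k] by (cases "x = lambda k") auto
  then have "poly (lambda_poly k) x * lambda k ^ k < 0"
    using lambda_poly_cross_less[of k x "lambda k"] lambda_root[OF k] k \<open>0 < x\<close> by simp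
  then show False
    using pos lambda_root(1)[OF k] by (simp add: mult_less_0_iff)
qed

lemma lambda_poly_times:
  fixes x :: real
  assumes "k \<ge> 2"
  shows "(x - 1) * poly (lambda_poly k) x = x ^ (k - 1) * (x\<^sup>2 - x - 1) + 1"
proof -
  obtain n where n: "k = n + 2"
    using assms by (metis add.commute le_Suc_ex)
  have "(x - 1) * (\<Sum>j = 0..n. x ^ j) = x ^ Suc n - 1"
    by (induction n) (simp_all add: algebra_simps)
  then show ?thesis
    by (simp add: n poly_lambda_poly algebra_simps power2_eq_square)
qed

lemma less_lambdaI:
  assumes k: "k \<ge> 3" and x: "1 < x" and "x ^ (k - 1) * (x\<^sup>2 - x - 1) + 1 < 0"
  shows "x < lambda k"
proof -
  have "(x - 1) * poly (lambda_poly k) x < 0"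
    using assms lambda_poly_times[of k x] by simp
  then show ?thesis
    using less_lambda[of k x] k x by (simp add: mult_less_0_iff)
qed

lemma lambda_lessI:
  assumes k: "k \<ge> 3" and x: "1 < x" and "0 < x ^ (k - 1) * (x\<^sup>2 - x - 1) + 1"
  shows "lambda k < x"
proof -
  have "0 < (x - 1) * poly (lambda_poly k) x"
    using assms lambda_poly_times[of k x] by simp
  then show ?thesis
    using lambda_less[of k x] k x by (simp add: zero_less_mult_iff)
qed

section \<open>Estimates for Fibonacci numbers\<close>

text \<open>Cassini's identity, in the form that evaluates \<open>x^2 - x - 1\<close> at a quotient of consecutive
  Fibonacci numbers.\<close>

lemma fib_quadratic_form:
  "(real (fib (n + 1)))\<^sup>2 - real (fib (n + 1)) * real (fib n) - (real (fib n))\<^sup>2 = (- 1) ^ n"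
  by (induction n) (simp_all add: power2_eq_square algebra_simps)

lemma fib_ratio_bounds:
  assumes "n \<ge> 3"
  shows "3 * fib n \<le> 2 * fib (n + 1)" "3 * fib (n + 1) \<le> 5 * fib n"
  using assms by (induction n rule: dec_induct) (simp_all add: numeral_eq_Suc)

lemma power_less_fib_square:
  assumes "n \<ge> 3"
  shows "(5 / 3) ^ (n - 1) < (real (fib n))\<^sup>2"
  using assms
proof (induction n rule: dec_induct)
  case base
  then show ?case by (simp add: numeral_eq_Suc)
next
  case (step n)
  have "(3 / 2 * real (fib n))\<^sup>2 \<le> (real (fib (Suc n)))\<^sup>2"
    using fib_ratio_bounds(1)[OF step(1)] by (intro power_mono) auto
  moreover have "(5 / 3 :: real) ^ (Suc n - 1) = 5 / 3 * (5 / 3) ^ (n - 1)"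
    using step(1) by (cases n) auto
  moreover have "(3 / 2 * real (fib n))\<^sup>2 = 9 / 4 * (real (fib n))\<^sup>2"
    by (simp add: power2_eq_square)
  ultimately show ?case
    using step.IH zero_le_power2[of "real (fib n)"] by linarith
qed

lemma fib_Suc_golden:
  fixes p :: real
  assumes "p\<^sup>2 = p + 1"
  shows "real (fib (n + 1)) = p * real (fib n) + (1 - p) ^ n"
proof (induction n)
  case (Suc n)
  have "p * p = p + 1" using assms by (simp add: power2_eq_square)
  \<comment> \<open>\<open>1 - p\<close> is the conjugate root, so it is the negative of the reciprocal of \<open>p\<close>.\<close>
  then have conj: "p * (1 - p) = - 1" by (simp add: algebra_simps)
  have "p * real (fib (Suc n)) + (1 - p) ^ Suc n
      = p * real (fib (n + 1)) + (1 - p) * (real (fib (n + 1)) - p * real (fib n))"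
    using Suc.IH by simp
  also have "\<dots> = real (fib (n + 1)) - (p * (1 - p)) * real (fib n)"
    by (simp add: algebra_simps)
  finally show ?case
    using conj by simp
qed simp

lemma fib_le_golden_power:
  fixes p :: real
  assumes "p\<^sup>2 = p + 1" "1 \<le> p"
  shows "real (fib (n + 1)) \<le> p ^ n"
proof (induction n rule: fib.induct)
  case (3 n)
  have "p ^ Suc (Suc n) = p ^ Suc n + p ^ n"
    using assms(1) by (simp add: power2_eq_square algebra_simps flip: mult.assoc)
  then show ?case using 3 by simp
qed (use assms in simp_all)

lemma fib_ge_linear:
  assumes "n \<ge> 7"
  shows "7 * (n - 1) \<le> 3 * (fib n + 1)" "13 \<le> fib n"
proof -
  have "7 * (n - 1) \<le> 3 * (fib n + 1) \<and> 13 \<le> fib n \<and> 8 \<le> fib (n - 1)"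
    using assms
  proof (induction n rule: dec_induct)
    case base
    then show ?case by (simp add: numeral_eq_Suc)
  next
    case (step n)
    then obtain m where "n = Suc m" by (cases n) auto
    with step show ?case by simp
  qed
  then show "7 * (n - 1) \<le> 3 * (fib n + 1)" "13 \<le> fib n" by auto
qed

text \<open>The right-hand side is asymptotically a constant multiple, well above 1, of \<open>b^2\<close>. The crude
  constants below lose most of that room, which is why they only work from \<open>k = 7\<close> on.\<close>

lemma lower_quotient_power_large:
  assumes k: "k \<ge> 4"
  defines "a \<equiv> real (fib (k + 1))" and "b \<equiv> real (fib k)"
  shows "(b + 1)\<^sup>2 < (a / (b + 1)) ^ (k - 1) * (a + 2 * b)"
proof -
  consider "k = 4" | "k = 5" | "k = 6" | "k \<ge> 7" using k by linarith
  then show ?thesis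
  proof cases
    assume k7: "k \<ge> 7"
    define p :: real where "p = (1 + sqrt 5) / 2"
    have p2: "p\<^sup>2 = p + 1"
      by (simp add: p_def power2_eq_square field_simps)
    have "2 < sqrt 5" "sqrt 5 < 3"
      by (auto intro: real_less_rsqrt real_less_lsqrt)
    then have p: "3 / 2 < p" "p < 2"
      unfolding p_def by simp_all
    have "\<bar>(1 - p) ^ k\<bar> \<le> \<bar>1 - p\<bar> ^ 1"
      unfolding power_abs using p k by (intro power_decreasing) auto
    then have "- (p - 1) \<le> (1 - p) ^ k"
      using p by (simp add: abs_le_iff)
    moreover have "p - 1 \<le> p / 2"
      using p by simp
    ultimately have a_ge: "p * b - p / 2 \<le> a"
      using fib_Suc_golden[OF p2, of k] by (simp add: a_def b_def)
    have b13: "13 \<le> b"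
      using fib_ge_linear(2)[OF k7] by (simp add: b_def)
    have lin: "7 * real (k - 1) \<le> 3 * (b + 1)"
      using of_nat_mono[OF fib_ge_linear(1)[OF k7], where 'a = real] by (simp add: b_def)
    \<comment> \<open>A bound for the relative amount by which the quotient can fall short of \<open>p\<close>: the
      denominator contributes \<open>1 / (b + 1)\<close>, the term \<open>p / 2\<close> at most half of that.\<close>
    define d where "d = 3 / 2 / (b + 1)"
    have d: "0 \<le> d" "d \<le> 1" "real (k - 1) * d \<le> 9 / 14"
      using b13 lin by (simp_all add: d_def field_simps)
    have "p * (1 - d) = (p * b - p / 2) / (b + 1)"
      using b13 by (simp add: d_def field_simps)
    also have "\<dots> \<le> a / (b + 1)"
      using a_ge b13 by (intro divide_right_mono) auto
    finally have quot: "p * (1 - d) \<le> a / (b + 1)" .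
    have "5 / 14 \<le> 1 + real (k - 1) * (- d)"
      using d by simp
    also have "\<dots> \<le> (1 + (- d)) ^ (k - 1)"
      using d by (intro Bernoulli_inequality) auto
    finally have bern: "5 / 14 \<le> (1 - d) ^ (k - 1)" by simp
    have "b \<le> p ^ (k - 1)"
      using fib_le_golden_power[OF p2, of "k - 1"] p k by (simp add: b_def)
    then have "b * (5 / 14) \<le> p ^ (k - 1) * (1 - d) ^ (k - 1)"
      using bern b13 p by (intro mult_mono) auto
    also have "\<dots> = (p * (1 - d)) ^ (k - 1)"
      by (simp add: power_mult_distrib)
    also have "\<dots> \<le> (a / (b + 1)) ^ (k - 1)"
      using quot p d by (intro power_mono) auto
    finally have pow: "b * (5 / 14) \<le> (a / (b + 1)) ^ (k - 1)" .
    have "3 / 2 * b \<le> a"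
      using fib_ratio_bounds(1)[of k] k by (simp add: a_def b_def)
    then have "b * (5 / 14) * (7 / 2 * b) \<le> (a / (b + 1)) ^ (k - 1) * (a + 2 * b)"
      using pow b13 by (intro mult_mono) auto
    moreover have "(b + 1)\<^sup>2 < b * (5 / 14) * (7 / 2 * b)"
    proof -
      have "13 * b \<le> b * b"
        using b13 by (intro mult_right_mono) auto
      then have "b * b + 2 * b + 1 < 5 / 4 * (b * b)"
        using b13 by linarith
      then show ?thesis
        by (simp add: power2_eq_square algebra_simps)
    qed
    ultimately show ?thesis by linarith
  qed (simp_all add: a_def b_def numeral_eq_Suc field_simps)
qed

section \<open>The two bounds\<close>

lemma lambda_less_fib_quotient:
  assumes k: "k \<ge> 3"
  shows "lambda k < real (fib (k + 1)) / real (fib k)"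
proof (rule lambda_lessI[OF k])
  define a b where ab: "a = real (fib (k + 1))" "b = real (fib k)"
  have b: "0 < b"
    using k fib_neq_0_nat[of k] by (simp add: ab)
  have ratio: "3 / 2 \<le> a / b" "a / b \<le> 5 / 3"
    using fib_ratio_bounds[OF k] b by (simp_all add: ab field_simps)
  have "1 < a / b"
    using ratio(1) by linarith
  then show "1 < real (fib (k + 1)) / real (fib k)"
    by (simp only: ab)
  have "(a / b)\<^sup>2 - a / b - 1 = (a\<^sup>2 - a * b - b\<^sup>2) / b\<^sup>2"
    using b by (simp add: field_simps power2_eq_square)
  then have quad: "(a / b)\<^sup>2 - a / b - 1 = (- 1) ^ k / b\<^sup>2"
    using fib_quadratic_form[of k] by (simp add: ab)
  have "(a / b) ^ (k - 1) \<le> (5 / 3) ^ (k - 1)"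
    using ratio by (intro power_mono) (auto simp: ab)
  also have "\<dots> < b\<^sup>2"
    using power_less_fib_square[OF k] by (simp add: ab)
  finally have small: "(a / b) ^ (k - 1) / b\<^sup>2 < 1"
    using b by simp
  have "0 \<le> (a / b) ^ (k - 1) / b\<^sup>2"
    by (simp add: ab)
  then have "0 < (a / b) ^ (k - 1) * ((a / b)\<^sup>2 - a / b - 1) + 1"
    unfolding quad using small by (cases "even k") auto
  then show "0 < (real (fib (k + 1)) / real (fib k)) ^ (k - 1) *
      ((real (fib (k + 1)) / real (fib k))\<^sup>2 - real (fib (k + 1)) / real (fib k) - 1) + 1"
    by (simp add: ab)
qed

lemma fib_quotient_less_lambda:
  assumes k: "k \<ge> 3"
  shows "real (fib (k + 1)) / (real (fib k) + 1) < lambda k"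
proof (cases "k = 3")
  case True
  have "1 < lambda 3"
    by (rule less_lambda) (simp_all add: poly_lambda_poly)
  with True show ?thesis
    by (simp add: numeral_eq_Suc)
next
  case False
  with k have k4: "k \<ge> 4" by simp
  define a b where ab: "a = real (fib (k + 1))" "b = real (fib k)"
  have "fib 4 \<le> fib k"
    using k4 by (rule fib_mono)
  then have b3: "3 \<le> b"
    by (simp add: ab numeral_eq_Suc)
  have "3 / 2 * b \<le> a"
    using fib_ratio_bounds(1)[OF k] by (simp add: ab)
  with b3 have x1: "1 < a / (b + 1)"
    by simp
  have "a\<^sup>2 - a * (b + 1) - (b + 1)\<^sup>2 = (- 1) ^ k - (a + 2 * b + 1)"
    using fib_quadratic_form[of k] by (simp add: ab power2_eq_square algebra_simps)
  also have "\<dots> \<le> - (a + 2 * b)"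
    by (cases "even k") auto
  finally have "(a\<^sup>2 - a * (b + 1) - (b + 1)\<^sup>2) / (b + 1)\<^sup>2 \<le> - (a + 2 * b) / (b + 1)\<^sup>2"
    by (rule divide_right_mono) simp
  moreover have "(a / (b + 1))\<^sup>2 - a / (b + 1) - 1
      = (a\<^sup>2 - a * (b + 1) - (b + 1)\<^sup>2) / (b + 1)\<^sup>2"
  proof -
    have "b + 1 \<noteq> 0" using b3 by simp
    then show ?thesis
      by (simp add: diff_divide_distrib power_divide) (simp add: power2_eq_square)
  qed
  ultimately have "(a / (b + 1)) ^ (k - 1) * ((a / (b + 1))\<^sup>2 - a / (b + 1) - 1)
      \<le> (a / (b + 1)) ^ (k - 1) * (- (a + 2 * b) / (b + 1)\<^sup>2)"
    using x1 by (intro mult_left_mono) auto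
  also have "\<dots> = - ((a / (b + 1)) ^ (k - 1) * (a + 2 * b) / (b + 1)\<^sup>2)"
    by (simp only: minus_divide_left mult_minus_right times_divide_eq_right)
  also have "\<dots> < - 1"
    using lower_quotient_power_large[OF k4] b3 by (simp only: ab[symmetric]) simp
  finally have "a / (b + 1) < lambda k"
    using x1 by (intro less_lambdaI[OF k]) auto
  then show ?thesis
    by (simp add: ab)
qed

theorem theorem2p4:
  fixes k :: nat
  assumes "k \<ge> 3"
  shows "real (fib (k + 1)) / (real (fib k) + 1) < lambda k
    \<and> lambda k < real (fib (k + 1)) / real (fib k)"
  using fib_quotient_less_lambda[OF assms] lambda_less_fib_quotient[OF assms] by simp

end
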